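(* Let $r>0$, let $x_1<x_2<\cdots<x_m$ be real numbers, and let $f:\mathbb{R}\to\mathbb{R}$ be a convex piecewise cubic function: $$f(x)=\begin{cases} f_0(x),&\text{if }x\le x_1,\\ f_1(x),&\text{if }x_1\le x\le x_2,\\ \ \vdots\\ f_m(x),&\text{if }x_m\le x,\end{cases}$$ where $$f_i(x)=a_ix^3+b_ix^2+c_ix+d_i,\qquad a_i,b_i,c_i,d_i\in\mathbb{R}.$$ For each $i\in\{0,1,\dots,m\}$ define $$p_i=p_i(x)=\frac{-(2b_i+r)+\sqrt{(2b_i+r)^2-12a_i(c_i-rx)}}{6a_i}.$$ Partition $\operatorname{dom} f$ as follows: $$S_0=\left(-\infty,\;x_1+\tfrac1r(3a_0x_1^2+2b_0x_1+c_0)\right),$$ $$S_{2i-1}=\left[x_i+\tfrac1r(3a_{i-1}x_i^2+2b_{i-1}x_i+c_{i-1}),\;x_i+\tfrac1r(3a_ix_i^2+2b_ix_i+c_i)\right]\quad(1\le i\le m),$$ $$S_{2i}=\left(x_i+\tfrac1r(3a_ix_i^2+2b_ix_i+c_i),\;x_{i+1}+\tfrac1r(3a_ix_{i+1}^2+2b_ix_{i+1}+c_i)\right)\quad(1\le i\le m-1),$$ $$S_{2m}=\left(x_m+\tfrac1r(3a_mx_m^2+2b_mx_m+c_m),\;\infty\right).$$ Then the proximal mapping and the Moreau envelope of $f$ are $$P_rf(x)=\begin{cases}p_i,&\text{if }x\in S_{2i},\ 0\le i\le m,\\ x_i,&\text{if }x\in S_{2i-1},\ 1\le i\le m,\end{cases}$$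 $$e_rf(x)=\begin{cases}f_i(p_i)+\frac r2(p_i-x)^2,&\text{if }x\in S_{2i},\ 0\le i\le m,\\ f_i(x_i)+\frac r2(x_i-x)^2,&\text{if }x\in S_{2i-1},\ 1\le i\le m.\end{cases}$$
   Context: For a function $f:\mathbb{R}\to\mathbb{R}\cup\{\infty\}$ and $r>0$, the Moreau envelope is $e_rf(x)=\inf_{y\in\mathbb{R}}\{f(y)+\frac r2(y-x)^2\}$ and the proximal mapping is $P_rf(x)=\operatorname{argmin}_{y\in\mathbb{R}}\{f(y)+\frac r2(y-x)^2\}$ (the set of points attaining the infimum, identified with its element when it is a singleton). A function $f:\mathbb{R}\to\mathbb{R}$ is piecewise cubic if $\operatorname{dom} f$ can be represented as the union of finitely many closed intervals, relative to each of which $f(x)$ is given by an expression of the form $ax^3+bx^2+cx+d$ with $a,b,c,d\in\mathbb{R}$.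
   Formalization: Where a_i = 0 the printed quotient for p_i is undefined (division by 6a_i = 0); there p_i is taken to be (rx − c_i)/(2b_i + r), the limit of the printed formula as a_i → 0; for a_i ≠ 0 the formula is as printed. *)

theory Defs
  imports "HOL-Analysis.Analysis"
begin

definition moreau_envelope :: "real \<Rightarrow> (real \<Rightarrow> ereal) \<Rightarrow> real \<Rightarrow> ereal" where
  "moreau_envelope r f x = (INF y. f y + ereal (r / 2 * (y - x)\<^sup>2))"

definition prox :: "real \<Rightarrow> (real \<Rightarrow> ereal) \<Rightarrow> real \<Rightarrow> real set" where
  "prox r f x = {y. f y + ereal (r / 2 * (y - x)\<^sup>2) = moreau_envelope r f x}"

definition cubic :: "real \<Rightarrow> real \<Rightarrow> real \<Rightarrow> real \<Rightarrow> real \<Rightarrow> real" where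
  "cubic a b c d y = a * y ^ 3 + b * y\<^sup>2 + c * y + d"

(* The solution y of 3 a y^2 + 2 b y + c + r (y - x) = 0 on the branch where
   6 a y + 2 b + r > 0.  For a = 0 the quotient is 0/0 (and would be 0 under the
   HOL convention); the value there is the limit as a tends to 0, see cubic_prox_tendsto,
   which is the solution of the then linear equation. *)
definition cubic_prox :: "real \<Rightarrow> real \<Rightarrow> real \<Rightarrow> real \<Rightarrow> real \<Rightarrow> real" where
  "cubic_prox r a b c x =
    (if a = 0 then (r * x - c) / (2 * b + r)
     else (- (2 * b + r) + sqrt ((2 * b + r)\<^sup>2 - 12 * a * (c - r * x))) / (6 * a))"

lemma cubic_prox_tendsto:
  assumes "2 * b + r > 0"
  shows "((\<lambda>a. (- (2 * b + r) + sqrt ((2 * b + r)\<^sup>2 - 12 * a * (c - r * x))) / (6 * a))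
           \<longlongrightarrow> cubic_prox r 0 b c x) (at 0)"
proof -
  define B k where "B = 2 * b + r" and "k = c - r * x"
  have B: "B > 0" using assms by (simp add: B_def)
  have "((\<lambda>a. sqrt (B\<^sup>2 - 12 * a * k)) has_field_derivative (- 6 * k / B)) (at 0)"
    using B by (auto intro!: derivative_eq_intros simp: field_simps)
  then have "((\<lambda>a. (sqrt (B\<^sup>2 - 12 * a * k) - B) / a) \<longlongrightarrow> - 6 * k / B) (at 0)"
    using B by (simp add: has_field_derivative_iff)
  from tendsto_divide[OF this tendsto_const[of 6]]
  have "((\<lambda>a. (sqrt (B\<^sup>2 - 12 * a * k) - B) / a / 6) \<longlongrightarrow> - 6 * k / B / 6) (at 0)"
    by simp
  moreover have "- 6 * k / B / 6 = cubic_prox r 0 b c x"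
    using B by (simp add: cubic_prox_def k_def flip: B_def) (simp add: field_simps)
  moreover have "(\<lambda>a. (sqrt (B\<^sup>2 - 12 * a * k) - B) / a / 6) =
      (\<lambda>a. (- B + sqrt (B\<^sup>2 - 12 * a * k)) / (6 * a))"
    by (simp add: mult.commute)
  ultimately show ?thesis by (simp add: B_def k_def)
qed

end

theory Submission
  imports Defs
begin

text \<open>
  On a closed piece the derivative of the cubic is a subgradient of \<open>f\<close>: at interior points by
  convexity, at the end points by continuity. A point \<open>y\<close> is the proximal point of \<open>t\<close> as soon
  as \<open>r * (t - y)\<close> is a subgradient of \<open>f\<close> at \<open>y\<close>. So the breakpoint \<open>x i\<close> is the proximal
  point of exactly those \<open>t\<close> for which \<open>r * (t - x i)\<close> lies between the two one-sided derivatives.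
  Inside a piece \<open>y\<close> is a root of a quadratic equation in which convexity singles out the
  branch \<open>6 * a * y + 2 * b + r > 0\<close>.
\<close>

section \<open>Proximal points and subgradients\<close>

lemma prox_of_subgradient:
  fixes f :: "real \<Rightarrow> real"
  assumes r: "r > 0" and sub: "\<And>z. f y + r * (t - y) * (z - y) \<le> f z"
  shows "prox r (\<lambda>z. ereal (f z)) t = {y}"
    and "moreau_envelope r (\<lambda>z. ereal (f z)) t = ereal (f y + r / 2 * (y - t)\<^sup>2)"
proof -
  \<comment> \<open>Expanding the squares turns the linear term of the subgradient inequality into a
    surplus \<open>r / 2 * (z - y)\<^sup>2\<close>. Dropping the surplus gives minimality of
    \<open>y\<close>, keeping it gives uniqueness.\<close>
  have growth: "f y + r / 2 * (y - t)\<^sup>2 + r / 2 * (z - y)\<^sup>2 \<le> f z + r / 2 * (z - t)\<^sup>2" for z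
  proof -
    have "r / 2 * (y - t)\<^sup>2 + r / 2 * (z - y)\<^sup>2 = r * (t - y) * (z - y) + r / 2 * (z - t)\<^sup>2"
      by (simp add: power2_eq_square algebra_simps)
    with sub[of z] show ?thesis by linarith
  qed
  have "f y + r / 2 * (y - t)\<^sup>2 \<le> f z + r / 2 * (z - t)\<^sup>2" for z
    using growth[of z] r zero_le_power2[of "z - y"]
    by (smt (verit) divide_pos_pos mult_nonneg_nonneg)
  then show env: "moreau_envelope r (\<lambda>z. ereal (f z)) t = ereal (f y + r / 2 * (y - t)\<^sup>2)"
    unfolding moreau_envelope_def by (intro INF_eqI) auto
  have "z = y" if "f z + r / 2 * (z - t)\<^sup>2 = f y + r / 2 * (y - t)\<^sup>2" for z
  proof -
    have "r / 2 * (z - y)\<^sup>2 \<le> 0" using growth[of z] that by linarith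
    with r have "(z - y)\<^sup>2 \<le> 0" by (simp add: mult_le_0_iff)
    then show ?thesis by simp
  qed
  then show "prox r (\<lambda>z. ereal (f z)) t = {y}"
    unfolding prox_def env by auto
qed

section \<open>Convex functions that are cubic on a piece\<close>

lemma has_field_derivative_cubic:
  "(cubic a b c d has_field_derivative (3 * a * y\<^sup>2 + 2 * b * y + c)) (at y)"
  unfolding cubic_def by (auto intro!: derivative_eq_intros simp: power2_eq_square)

text \<open>The hypothesis on \<open>K\<close> covers bounded intervals and rays at once and makes
  every point of \<open>K\<close> a limit of interior points. The limit is taken in the cubic, whose
  continuity is evident. Only \<open>y\<close> is confined to \<open>K\<close>; the bound at
  arbitrary \<open>z\<close> is what links different pieces.\<close>

lemma convex_cubic_piece_subgradient:
  fixes f :: "real \<Rightarrow> real"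
  assumes convex: "convex_on UNIV f" and K: "K \<subseteq> closure (interior K)"
    and f: "\<And>s. s \<in> K \<Longrightarrow> f s = cubic a b c d s" and y: "y \<in> K"
  shows "f y + (3 * a * y\<^sup>2 + 2 * b * y + c) * (z - y) \<le> f z"
proof -
  have inner: "cubic a b c d w + (3 * a * w\<^sup>2 + 2 * b * w + c) * (z - w) \<le> f z"
    if w: "w \<in> interior K" for w
  proof -
    have "eventually (\<lambda>s. s \<in> interior K) (nhds w)"
      using w by (intro eventually_nhds_in_open) auto
    then have "eventually (\<lambda>s. f s = cubic a b c d s) (nhds w)"
      by eventually_elim (use f interior_subset in blast)
    then have "(f has_field_derivative (3 * a * w\<^sup>2 + 2 * b * w + c)) (at w)"
      using DERIV_cong_ev[OF refl _ refl] has_field_derivative_cubic by blast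
    then have "f z - f w \<ge> (3 * a * w\<^sup>2 + 2 * b * w + c) * (z - w)"
      by (intro convex_on_imp_above_tangent[OF convex]) (auto simp: has_field_derivative_at_within)
    then show ?thesis using f[of w] w interior_subset by fastforce
  qed
  have "continuous_on (closure (interior K))
      (\<lambda>y. cubic a b c d y + (3 * a * y\<^sup>2 + 2 * b * y + c) * (z - y))"
    unfolding cubic_def by (intro continuous_intros)
  from continuous_le_on_closure[OF this subsetD[OF K y] inner] show ?thesis
    using f[OF y] by simp
qed

text \<open>Adding the two inequalities cancels the values of \<open>f\<close>. The slopes may come
  from different cubics, so this serves within a piece and across a breakpoint alike.\<close>

lemma subgradients_mono:
  fixes f :: "real \<Rightarrow> real"
  assumes "f y + g * (z - y) \<le> f z" "f z + h * (y - z) \<le> f y" "y < z"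
  shows "g \<le> h"
proof -
  have "(g - h) * (z - y) \<le> 0" using assms by (simp add: algebra_simps)
  then show ?thesis using assms(3) by (simp add: mult_le_0_iff)
qed

lemma convex_cubic_piece_deriv_mono:
  fixes f :: "real \<Rightarrow> real"
  assumes "convex_on UNIV f" "K \<subseteq> closure (interior K)"
    and "\<And>s. s \<in> K \<Longrightarrow> f s = cubic a b c d s"
  shows "mono_on K (\<lambda>y. 3 * a * y\<^sup>2 + 2 * b * y + c)"
proof (rule mono_onI)
  fix y z assume yz: "y \<in> K" "z \<in> K" "y \<le> z"
  show "3 * a * y\<^sup>2 + 2 * b * y + c \<le> 3 * a * z\<^sup>2 + 2 * b * z + c"
  proof (cases "y = z")
    case False
    then have "y < z" using yz by simp
    from subgradients_mono[OF convex_cubic_piece_subgradient convex_cubic_piece_subgradient this,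
        OF assms yz(1) assms yz(2)]
    show ?thesis .
  qed simp
qed

text \<open>Monotonicity of the first derivative gives the sign at interior points, and continuity
  extends it to \<open>K\<close>. Adding \<open>r > 0\<close> yields the strict branch condition of
  \<open>cubic_prox_eqI\<close>.\<close>

lemma convex_cubic_piece_second_deriv_nonneg:
  fixes f :: "real \<Rightarrow> real"
  assumes "convex_on UNIV f" and K: "K \<subseteq> closure (interior K)"
    and "\<And>s. s \<in> K \<Longrightarrow> f s = cubic a b c d s" and y: "y \<in> K"
  shows "0 \<le> 6 * a * y + 2 * b"
proof -
  have inner: "0 \<le> 6 * a * w + 2 * b" if "w \<in> interior K" for w
  proof (rule mono_on_imp_deriv_nonneg[OF convex_cubic_piece_deriv_mono[OF assms(1-3)] _ that])
    show "((\<lambda>y. 3 * a * y\<^sup>2 + 2 * b * y + c) has_real_derivative 6 * a * w + 2 * b) (at w)"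
      by (auto intro!: derivative_eq_intros)
  qed
  have "continuous_on (closure (interior K)) (\<lambda>y. 6 * a * y + 2 * b)"
    by (intro continuous_intros)
  from continuous_ge_on_closure[OF this subsetD[OF K y] inner] show ?thesis .
qed

text \<open>At a root, the discriminant is the square of the derivative
  \<open>6 * a * y + 2 * b + r\<close> of the quadratic, so the branch condition decides the sign of
  its square root. For \<open>a = 0\<close> the same condition makes the denominator
  \<open>2 * b + r\<close> positive.\<close>

lemma cubic_prox_eqI:
  assumes root: "3 * a * y\<^sup>2 + 2 * b * y + c = r * (t - y)" and branch: "6 * a * y + 2 * b + r > 0"
  shows "cubic_prox r a b c t = y"
proof (cases "a = 0")
  case True
  then show ?thesis using assms by (simp add: cubic_prox_def field_simps)
next
  case False
  have "(6 * a * y + 2 * b + r)\<^sup>2 = (2 * b + r)\<^sup>2 - 12 * a * (c - r * t)"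
    using root by algebra
  then have "sqrt ((2 * b + r)\<^sup>2 - 12 * a * (c - r * t)) = 6 * a * y + 2 * b + r"
    using branch by (intro real_sqrt_unique) auto
  then show ?thesis using False by (simp add: cubic_prox_def)
qed

text \<open>The equation for \<open>y\<close> is the optimality condition "derivative equals
  \<open>r * (t - y)\<close>", solved for \<open>t\<close>. Any solution in \<open>K\<close> is both
  the proximal point and the value of the closed formula, so only the existence of a solution is
  left to the theorem.\<close>

lemma convex_cubic_piece_prox:
  fixes f :: "real \<Rightarrow> real"
  assumes r: "r > 0" and piece: "convex_on UNIV f" "K \<subseteq> closure (interior K)"
      "\<And>s. s \<in> K \<Longrightarrow> f s = cubic a b c d s"
    and y: "y \<in> K" "y + 1 / r * (3 * a * y\<^sup>2 + 2 * b * y + c) = t"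
  shows "prox r (\<lambda>z. ereal (f z)) t = {cubic_prox r a b c t}"
    and "moreau_envelope r (\<lambda>z. ereal (f z)) t =
      ereal (cubic a b c d (cubic_prox r a b c t) + r / 2 * (cubic_prox r a b c t - t)\<^sup>2)"
proof -
  have root: "3 * a * y\<^sup>2 + 2 * b * y + c = r * (t - y)"
    using y(2) r by (auto simp: field_simps)
  have eq: "cubic_prox r a b c t = y"
    using convex_cubic_piece_second_deriv_nonneg[OF piece y(1)] r
    by (intro cubic_prox_eqI root) auto
  have sub: "f y + r * (t - y) * (z - y) \<le> f z" for z
    using convex_cubic_piece_subgradient[OF piece y(1)] root by simp
  show "prox r (\<lambda>z. ereal (f z)) t = {cubic_prox r a b c t}"
    using prox_of_subgradient(1)[of r f, OF r sub] eq by simp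
  show "moreau_envelope r (\<lambda>z. ereal (f z)) t =
      ereal (cubic a b c d (cubic_prox r a b c t) + r / 2 * (cubic_prox r a b c t - t)\<^sup>2)"
    using prox_of_subgradient(2)[of r f, OF r sub] eq piece(3)[OF y(1)] by simp
qed

section \<open>Open and closed intervals alternating along the line\<close>

lemma le_double_cases:
  fixes j m :: nat
  assumes "j \<le> 2 * m"
  obtains (first) "j = 0" | (odd) i where "j = 2 * i - 1" "1 \<le> i" "i \<le> m"
    | (even) i where "j = 2 * i" "1 \<le> i" "i < m" | (last) "j = 2 * m"
proof (cases "even j")
  case True
  then obtain i where i: "j = 2 * i" by blast
  then show ?thesis using assms first even[of i] last by (cases "i = 0"; cases "i = m") auto
next
  case False
  then obtain i where "j = 2 * i + 1" by (elim oddE)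
  then show ?thesis using assms odd[of "i + 1"] by auto
qed

text \<open>By induction, the sets before \<open>S (2 * i - 1)\<close> fill the ray
  \<open>{..<L i}\<close> and those before \<open>S (2 * i)\<close> the ray \<open>{..U i}\<close>.
  Each further set starts where such a ray ends, which gives disjointness and, with the last set,
  covering. Strictness in \<open>U i < L (i + 1)\<close> keeps the open intervals nonempty, as
  \<open>partition_on\<close> demands; a closed one may shrink to a point.\<close>

lemma partition_interleaved_intervals:
  fixes L U :: "nat \<Rightarrow> real" and S :: "nat \<Rightarrow> real set"
  assumes m: "1 \<le> m"
    and LU: "\<And>i. 1 \<le> i \<Longrightarrow> i \<le> m \<Longrightarrow> L i \<le> U i"
    and UL: "\<And>i. 1 \<le> i \<Longrightarrow> i < m \<Longrightarrow> U i < L (i + 1)"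
    and S_first: "S 0 = {..<L 1}"
    and S_odd: "\<And>i. 1 \<le> i \<Longrightarrow> i \<le> m \<Longrightarrow> S (2 * i - 1) = {L i..U i}"
    and S_even: "\<And>i. 1 \<le> i \<Longrightarrow> i < m \<Longrightarrow> S (2 * i) = {U i<..<L (i + 1)}"
    and S_last: "S (2 * m) = {U m<..}"
  shows "disjoint_family_on S {..2 * m}" and "partition_on UNIV (S ` {..2 * m})"
proof -
  have below: "(\<Union>j<2 * i - 1. S j) = {..<L i} \<and> (\<Union>j<2 * i. S j) = {..U i}"
    if "1 \<le> i" "i \<le> m" for i
    using that
  proof (induction i rule: dec_induct)
    case base
    have "{..<2 * 1 - 1} = {0::nat}" "{..<2 * 1} = {0::nat, 2 * 1 - 1}" by auto
    moreover have "{..<L 1} \<union> {L 1..U 1} = {..U 1}" using LU[of 1] m by auto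
    ultimately show ?case
      using S_first S_odd[of 1] m by simp
  next
    case (step i)
    have "{..<2 * Suc i - 1} = insert (2 * i) {..<2 * i}" by auto
    then have 1: "(\<Union>j<2 * Suc i - 1. S j) = {..<L (Suc i)}"
      using step S_even[of i] UL[of i] by auto
    have "{..<2 * Suc i} = insert (2 * Suc i - 1) {..<2 * Suc i - 1}" by auto
    then have "(\<Union>j<2 * Suc i. S j) = {..U (Suc i)}"
      using 1 step S_odd[of "Suc i"] LU[of "Suc i"] by auto
    with 1 show ?case by blast
  qed
  have new: "S j \<inter> S k = {}" if "j \<le> 2 * m" "k < j" for j k
  proof -
    have "S k \<subseteq> (\<Union>l<j. S l)" using that(2) by blast
    with that(1) show ?thesis
    proof (cases rule: le_double_cases)
      case (odd i)
      then show ?thesis using \<open>S k \<subseteq> _\<close> below[of i] S_odd[of i] by fastforce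
    next
      case (even i)
      then show ?thesis using \<open>S k \<subseteq> _\<close> below[of i] S_even[of i] by fastforce
    next
      case last
      then show ?thesis using \<open>S k \<subseteq> _\<close> below[of m] S_last m by fastforce
    qed (use that in simp)
  qed
  then show disj: "disjoint_family_on S {..2 * m}"
    unfolding disjoint_family_on_def by (metis Int_commute atMost_iff linorder_neqE_nat)
  have nonempty: "S j \<noteq> {}" if "j \<le> 2 * m" for j
    using that
  proof (cases rule: le_double_cases)
    case first
    then show ?thesis using S_first lt_ex by auto
  next
    case (odd i)
    then show ?thesis using S_odd[of i] LU[of i] by auto
  next
    case (even i)
    then show ?thesis using S_even[of i] UL[of i] by simp
  next
    case last
    then show ?thesis using S_last gt_ex by auto
  qed
  have "{..2 * m} = insert (2 * m) {..<2 * m}" by auto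
  then have "(\<Union>j\<le>2 * m. S j) = UNIV"
    using below[of m] m S_last by auto
  with disj nonempty show "partition_on UNIV (S ` {..2 * m})"
    by (auto simp: partition_on_def intro: disjoint_family_on_disjoint_image)
qed

section \<open>Assembly of the pieces of a convex piecewise cubic function\<close>

theorem corollary4p11:
  fixes r :: real and m :: nat
    and x a b c d :: "nat \<Rightarrow> real"
    and f :: "real \<Rightarrow> real"
    and S :: "nat \<Rightarrow> real set"
  assumes r: "r > 0"
    and m: "m \<ge> 1"
    and breakpoints: "\<And>i. 1 \<le> i \<Longrightarrow> i < m \<Longrightarrow> x i < x (i + 1)"
    and convex: "convex_on UNIV f"
    and f_first: "\<And>t. t \<le> x 1 \<Longrightarrow> f t = cubic (a 0) (b 0) (c 0) (d 0) t"
    and f_mid: "\<And>i t. 1 \<le> i \<Longrightarrow> i < m \<Longrightarrow> x i \<le> t \<Longrightarrow> t \<le> x (i + 1)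
                  \<Longrightarrow> f t = cubic (a i) (b i) (c i) (d i) t"
    and f_last: "\<And>t. x m \<le> t \<Longrightarrow> f t = cubic (a m) (b m) (c m) (d m) t"
    and S_first: "S 0 = {..< x 1 + 1 / r * (3 * a 0 * (x 1)\<^sup>2 + 2 * b 0 * x 1 + c 0)}"
    and S_odd: "\<And>i. 1 \<le> i \<Longrightarrow> i \<le> m \<Longrightarrow> S (2 * i - 1) =
          {x i + 1 / r * (3 * a (i - 1) * (x i)\<^sup>2 + 2 * b (i - 1) * x i + c (i - 1)) ..
           x i + 1 / r * (3 * a i * (x i)\<^sup>2 + 2 * b i * x i + c i)}"
    and S_even: "\<And>i. 1 \<le> i \<Longrightarrow> i < m \<Longrightarrow> S (2 * i) =
          {x i + 1 / r * (3 * a i * (x i)\<^sup>2 + 2 * b i * x i + c i) <..<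
           x (i + 1) + 1 / r * (3 * a i * (x (i + 1))\<^sup>2 + 2 * b i * x (i + 1) + c i)}"
    and S_last: "S (2 * m) = {x m + 1 / r * (3 * a m * (x m)\<^sup>2 + 2 * b m * x m + c m) <..}"
  shows "disjoint_family_on S {..2 * m} \<and> partition_on UNIV (S ` {..2 * m})
    \<and> (\<forall>i\<in>{0..m}. \<forall>t\<in>S (2 * i).
          prox r (\<lambda>y. ereal (f y)) t = {cubic_prox r (a i) (b i) (c i) t})
    \<and> (\<forall>i\<in>{1..m}. \<forall>t\<in>S (2 * i - 1).
          prox r (\<lambda>y. ereal (f y)) t = {x i})
    \<and> (\<forall>i\<in>{0..m}. \<forall>t\<in>S (2 * i).
          moreau_envelope r (\<lambda>y. ereal (f y)) t =
            ereal (cubic (a i) (b i) (c i) (d i) (cubic_prox r (a i) (b i) (c i) t)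
                   + r / 2 * (cubic_prox r (a i) (b i) (c i) t - t)\<^sup>2))
    \<and> (\<forall>i\<in>{1..m}. \<forall>t\<in>S (2 * i - 1).
          moreau_envelope r (\<lambda>y. ereal (f y)) t =
            ereal (cubic (a i) (b i) (c i) (d i) (x i) + r / 2 * (x i - t)\<^sup>2))"
proof -
  \<comment> \<open>The disjunctions remove the missing end point of the two outer pieces, so the
    arbitrary values \<open>x 0\<close> and \<open>x (m + 1)\<close> impose no bound.\<close>
  define K where "K i = {t. (i = 0 \<or> x i \<le> t) \<and> (i = m \<or> t \<le> x (i + 1))}" for i
  define D where "D i y = 3 * a i * y\<^sup>2 + 2 * b i * y + c i" for i y
  \<comment> \<open>\<open>L i\<close> and \<open>U i\<close> are \<open>x i + g / r\<close> with
    \<open>g\<close> the left and the right derivative of \<open>f\<close> at \<open>x i\<close>;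
    the piece to the left of \<open>x i\<close> has index \<open>i - 1\<close>.\<close>
  define L where "L i = x i + 1 / r * D (i - 1) (x i)" for i
  define U where "U i = x i + 1 / r * D i (x i)" for i
  have K_first: "K 0 = {..x 1}" and K_last: "K m = {x m..}"
    and K_mid: "\<And>i. 1 \<le> i \<Longrightarrow> i < m \<Longrightarrow> K i = {x i..x (i + 1)}"
    using m by (auto simp: K_def)
  have piece_cases: "i = 0 \<or> i = m \<or> (1 \<le> i \<and> i < m)" if "i \<le> m" for i
    using that by linarith
  have K_closure: "K i \<subseteq> closure (interior (K i))" if "i \<le> m" for i
    using piece_cases[OF that]
  proof (elim disjE)
    assume "1 \<le> i \<and> i < m"
    then show ?thesis using K_mid[of i] breakpoints[of i] by simp
  qed (simp_all add: K_first K_last)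
  have f_K: "f s = cubic (a i) (b i) (c i) (d i) s" if "i \<le> m" "s \<in> K i" for i s
    using piece_cases[OF that(1)] that(2) K_first K_last K_mid f_first f_mid f_last by auto
  note piece = convex K_closure f_K
  have sub: "f y + D i y * (z - y) \<le> f z" if "i \<le> m" "y \<in> K i" for i y z
    unfolding D_def by (rule convex_cubic_piece_subgradient[OF piece]) (use that in auto)
  have D_mono: "D i y \<le> D i z" if "i \<le> m" "y \<in> K i" "z \<in> K i" "y \<le> z" for i y z
    using mono_onD[OF convex_cubic_piece_deriv_mono[OF piece, of i]] that by (simp add: D_def)
  have x_K: "x i \<in> K (i - 1)" "x i \<in> K i" if "1 \<le> i" "i \<le> m" for i
    using that breakpoints[of i] breakpoints[of "i - 1"] m
    by (auto simp: K_def less_eq_real_def)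

  \<comment> \<open>\<open>subgradients_mono\<close> compares slopes at distinct points only. So the
    left slope is taken at an interior point \<open>w\<close> of the left piece, hence strictly
    below \<open>x i\<close>, and \<open>w\<close> then tends to \<open>x i\<close>.\<close>
  have D_jump: "D (i - 1) (x i) \<le> D i (x i)" if i: "1 \<le> i" "i \<le> m" for i
  proof (rule continuous_le_on_closure[where S = "interior (K (i - 1))" and f = "D (i - 1)"])
    show "x i \<in> closure (interior (K (i - 1)))"
      using subsetD[OF K_closure x_K(1)[OF i]] i by linarith
    show "continuous_on (closure (interior (K (i - 1)))) (D (i - 1))"
      unfolding D_def by (intro continuous_intros)
    fix w assume w: "w \<in> interior (K (i - 1))"
    have "K (i - 1) \<subseteq> {..x i}" using i by (auto simp: K_def)
    from subsetD[OF interior_mono[OF this] w] have "w < x i" by simp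
    moreover have "i - 1 \<le> m" "w \<in> K (i - 1)" using i subsetD[OF interior_subset w] by auto
    ultimately show "D (i - 1) w \<le> D i (x i)"
      using subgradients_mono[of f w _ "x i"] sub i(2) x_K(2)[OF i] by blast
  qed
  have LU: "L i \<le> U i" if "1 \<le> i" "i \<le> m" for i
    using D_jump[OF that] r by (simp add: L_def U_def divide_right_mono)
  have UL: "U i < L (i + 1)" if "1 \<le> i" "i < m" for i
  proof -
    have "D i (x i) \<le> D i (x (i + 1))"
      using that x_K[of i] x_K[of "i + 1"] breakpoints[of i] by (intro D_mono) auto
    then have "1 / r * D i (x i) \<le> 1 / r * D i (x (i + 1))"
      using r by (intro mult_left_mono) auto
    then show ?thesis using breakpoints[OF that] by (simp add: L_def U_def)
  qed
  have S_0: "S 0 = {..<L 1}" and S_m: "S (2 * m) = {U m<..}"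
    and S_odd': "\<And>i. 1 \<le> i \<Longrightarrow> i \<le> m \<Longrightarrow> S (2 * i - 1) = {L i..U i}"
    and S_even': "\<And>i. 1 \<le> i \<Longrightarrow> i < m \<Longrightarrow> S (2 * i) = {U i<..<L (i + 1)}"
    using S_first S_last S_odd S_even by (simp_all add: L_def U_def D_def)
  note partition = partition_interleaved_intervals[OF m LU UL S_0 S_odd' S_even' S_m]

  \<comment> \<open>The intermediate value theorem applies once \<open>t\<close> is bracketed by
    values at two points of \<open>K i\<close>. On a bounded piece the end points do this; on a ray
    the second point has to be constructed.\<close>
  have root: "\<exists>y\<in>K i. y + 1 / r * D i y = t" if i: "i \<le> m" and t: "t \<in> S (2 * i)" for i t
  proof -
    have "\<exists>u v. u \<in> K i \<and> v \<in> K i \<and> u \<le> v \<and> u + 1 / r * D i u \<le> t \<and> t \<le> v + 1 / r * D i v"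
      using piece_cases[OF i]
    proof (elim disjE)
      assume i0: "i = 0"
      \<comment> \<open>Since \<open>D 0\<close> is nondecreasing on \<open>K 0\<close>, a point
        \<open>u \<le> x 1\<close> lies far enough left as soon as
        \<open>u + 1 / r * D 0 (x 1) \<le> t\<close>. The minimum secures both bounds.\<close>
      define u where "u = min (x 1) (t - 1 / r * D 0 (x 1))"
      have K: "u \<in> K 0" "x 1 \<in> K 0" "u \<le> x 1" by (auto simp: K_first u_def)
      have "1 / r * D 0 u \<le> 1 / r * D 0 (x 1)"
        using D_mono[of 0, OF _ K] r by (intro mult_left_mono) auto
      moreover have "u \<le> t - 1 / r * D 0 (x 1)" by (simp add: u_def)
      ultimately have "u + 1 / r * D 0 u \<le> t" by linarith
      moreover have "t \<le> x 1 + 1 / r * D 0 (x 1)" using t S_0 by (simp add: i0 L_def)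
      ultimately show ?thesis using K unfolding i0 by blast
    next
      assume im: "i = m"
      \<comment> \<open>The mirror image: \<open>D m (x m)\<close> bounds \<open>D m v\<close> from
        below.\<close>
      define v where "v = max (x m) (t - 1 / r * D m (x m))"
      have K: "x m \<in> K m" "v \<in> K m" "x m \<le> v" by (auto simp: K_last v_def)
      have "1 / r * D m (x m) \<le> 1 / r * D m v"
        using D_mono[of m, OF _ K] r by (intro mult_left_mono) auto
      moreover have "t - 1 / r * D m (x m) \<le> v" by (simp add: v_def)
      ultimately have "t \<le> v + 1 / r * D m v" by linarith
      moreover have "x m + 1 / r * D m (x m) \<le> t" using t S_m by (simp add: im U_def)
      ultimately show ?thesis using K unfolding im by blast
    next
      assume i1: "1 \<le> i \<and> i < m"
      then have "x i \<in> K i" "x (i + 1) \<in> K i" "x i \<le> x (i + 1)"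
        using x_K(2)[of i] x_K(1)[of "i + 1"] breakpoints[of i] by simp_all
      moreover have "x i + 1 / r * D i (x i) \<le> t" "t \<le> x (i + 1) + 1 / r * D i (x (i + 1))"
        using t S_even'[of i] i1 by (simp_all add: L_def U_def)
      ultimately show ?thesis by blast
    qed
    then obtain u v where uv: "u \<in> K i" "v \<in> K i" "u \<le> v"
      "u + 1 / r * D i u \<le> t" "t \<le> v + 1 / r * D i v" by blast
    have "\<exists>y\<ge>u. y \<le> v \<and> y + 1 / r * D i y = t"
      by (rule IVT'[where f = "\<lambda>y. y + 1 / r * D i y"])
         (use uv r in \<open>auto simp: D_def intro!: continuous_intros\<close>)
    then obtain y where y: "u \<le> y" "y \<le> v" "y + 1 / r * D i y = t" by blast
    then have "y \<in> K i" using uv(1,2) unfolding K_def by force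
    with y(3) show ?thesis by blast
  qed
  have inner: "prox r (\<lambda>y. ereal (f y)) t = {cubic_prox r (a i) (b i) (c i) t}"
    "moreau_envelope r (\<lambda>y. ereal (f y)) t =
            ereal (cubic (a i) (b i) (c i) (d i) (cubic_prox r (a i) (b i) (c i) t)
                   + r / 2 * (cubic_prox r (a i) (b i) (c i) t - t)\<^sup>2)"
    if i: "i \<le> m" and t: "t \<in> S (2 * i)" for i t
  proof -
    obtain y where "y \<in> K i" "y + 1 / r * (3 * a i * y\<^sup>2 + 2 * b i * y + c i) = t"
      using root[OF i t] unfolding D_def by blast
    note * = convex_cubic_piece_prox[OF r convex K_closure[OF i] f_K[OF i] this]
    show "prox r (\<lambda>y. ereal (f y)) t = {cubic_prox r (a i) (b i) (c i) t}"
      "moreau_envelope r (\<lambda>y. ereal (f y)) t =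
            ereal (cubic (a i) (b i) (c i) (d i) (cubic_prox r (a i) (b i) (c i) t)
                   + r / 2 * (cubic_prox r (a i) (b i) (c i) t - t)\<^sup>2)"
      using * by blast+
  qed
  have kink: "prox r (\<lambda>y. ereal (f y)) t = {x i}"
    "moreau_envelope r (\<lambda>y. ereal (f y)) t =
            ereal (cubic (a i) (b i) (c i) (d i) (x i) + r / 2 * (x i - t)\<^sup>2)"
    if i: "1 \<le> i" "i \<le> m" and t: "t \<in> S (2 * i - 1)" for i t
  proof -
    have g: "D (i - 1) (x i) \<le> r * (t - x i)" "r * (t - x i) \<le> D i (x i)"
      using t[unfolded S_odd'[OF i]] r by (simp_all add: L_def U_def field_simps)
    \<comment> \<open>The sign of \<open>z - x i\<close> decides which one-sided derivative to use:
      the smaller one on the left, where multiplication by a nonpositive factor reverses the order,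
      and the larger one on the right.\<close>
    have sub': "f (x i) + r * (t - x i) * (z - x i) \<le> f z" for z
    proof (cases "z \<le> x i")
      case True
      then have "r * (t - x i) * (z - x i) \<le> D (i - 1) (x i) * (z - x i)"
        using g(1) by (intro mult_right_mono_neg) auto
      then show ?thesis using sub[of "i - 1" "x i" z] x_K[OF i] i by linarith
    next
      case False
      then have "r * (t - x i) * (z - x i) \<le> D i (x i) * (z - x i)"
        using g(2) by (intro mult_right_mono) auto
      then show ?thesis using sub[of i "x i" z] x_K[OF i] i by linarith
    qed
    show "prox r (\<lambda>y. ereal (f y)) t = {x i}"
      by (rule prox_of_subgradient[OF r sub'])
    show "moreau_envelope r (\<lambda>y. ereal (f y)) t =
            ereal (cubic (a i) (b i) (c i) (d i) (x i) + r / 2 * (x i - t)\<^sup>2)"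
      using prox_of_subgradient(2)[of r f, OF r sub'] f_K[of i "x i"] x_K[OF i] i by simp
  qed
  show ?thesis
    using partition inner kink by simp
qed

end
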